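(* Consider the fifth Painlevé equation $$w''=\left(\frac{1}{2w}+\frac{1}{w-1}\right)(w')^2-\frac{w'}{z}+\frac{(w-1)^2}{z^2}\left(\alpha w+\frac{\beta}{w}\right)+\frac{\gamma w}{z}+\frac{\delta w(w+1)}{w-1},$$ with complex parameters $\alpha,\beta,\gamma,\delta$. (i) Suppose $\alpha\beta\gamma\delta\neq 0$. Consider the five formal series solutions of this equation near $z=\infty$: $$(A_l)\quad (-1)^l\sqrt{\frac{\beta}{\delta}}\,\frac1z+\left(-\frac{2\beta}{\delta}+(-1)^l\frac{\gamma}{2\delta}\sqrt{\frac{\beta}{\delta}}\right)\frac{1}{z^2}+\sum_{s=3}^{\infty}\frac{c_{-s,l}}{z^s},\qquad l=1,2,$$ $$(B)\quad -1+\frac{2\gamma}{\delta z}+\sum_{s=2}^{\infty}\frac{c_{-s}}{z^s},$$ $$(C_l)\quad (-1)^l\sqrt{-\frac{\delta}{\alpha}}\,z+2+(-1)^l\frac{\gamma}{2\sqrt{-\alpha\delta}}+\sum_{s=1}^{\infty}\frac{c_{-s,l}}{z^s},\qquad l=1,2.$$ Then the series $(A_1),(A_2),(B)$ and the regular parts of the series $(C_1),(C_2)$ are of Gevrey order $1$ (in the variable $z$). (ii) Suppose $\alpha\beta\gamma\neq0$ and $\delta=0$. Consider the four formal series solutions of this equation near $z=\infty$: $$(D_l)\quad (-1)^l\sqrt{-\frac{\beta}{\gamma}}\,\frac{1}{\sqrt z}+\frac{\beta}{\gamma z}+\sum_{s=3}^{\infty}\frac{c_{-s,l}}{z^{s/2}},\qquad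 l=3,4,$$ $$(E_l)\quad (-1)^l\sqrt{-\frac{\gamma}{\alpha}}\,\sqrt z+1+\sum_{s=1}^{\infty}\frac{c_{-s,l}}{z^{s/2}},\qquad l=3,4.$$ Then the series $(D_3),(D_4),(E_3),(E_4)$, considered as series in the variable $\sqrt z$, are of Gevrey order $1$.
   Context: Formal solutions: for each family, once the parameters, the branches of the roots and $l$ are fixed, the coefficients $c_{-s},c_{-s,l}\in\mathbb{C}$ are the uniquely determined constants for which the series is a formal solution of the equation, i.e. satisfies formally the equation multiplied by $z^2w(w-1)$. Each of $\sqrt{\beta/\delta}$, $\sqrt{-\delta/\alpha}$, $\sqrt{-\beta/\gamma}$, $\sqrt{-\gamma/\alpha}$ denotes a fixed square root, and $\sqrt{-\alpha\delta}$ denotes the square root with $\sqrt{-\delta/\alpha}\,\sqrt{-\alpha\delta}=\delta$. Regular part: for a formal series $\sum_{k\ge -m}a_kx^{-k}$ in decreasing integer powers of a variable $x$ (expansion at $x=\infty$), the regular part is $\sum_{k\ge0}a_kx^{-k}$ and the principal part is the finite sum of the terms with positive powers of $x$. Gevrey order: a formal series $\sum_{k\ge0}a_kx^{-k}$ is of Gevrey order $1/\kappa$ (with $\kappa>0$) if there are constants $C,A>0$ with $|a_n|\le C\,(n!)^{1/\kappa}A^n$ for all $n\geq 0$; thus Gevrey order $1$ means $|a_n|\le C\,n!\,A^n$. A series with finitely many positive powers of $x$ is said to be of Gevrey order $1$ if its regular part is. *)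

theory Defs
  imports "HOL-Analysis.Analysis" "HOL-Computational_Algebra.Computational_Algebra"
begin

text \<open>
  A formal series with finitely many positive powers of \<open>x\<close>, expanded at \<open>x = \<infinity>\<close>, is represented
  by a formal Laurent series in \<open>X = 1/x\<close>: the coefficient of \<open>x\<^sup>-\<^sup>k\<close> in \<open>w\<close> is \<open>fls_nth w k\<close>, and the
  regular part of the series is \<open>fls_regpart w\<close>.  Throughout, \<open>x = z\<^sup>1\<^sup>/\<^sup>p\<close>, with \<open>p = 1\<close> for series
  in \<open>z\<close> and \<open>p = 2\<close> for series in \<open>\<surd>z\<close>.
\<close>

definition zvar :: "nat \<Rightarrow> complex fls" where
  "zvar p = fls_X_inv ^ p"

text \<open>By the chain rule, \<open>d/dz = (dX/dz) d/dX\<close> with \<open>X = z\<^sup>-\<^sup>1\<^sup>/\<^sup>p\<close>, so \<open>dX/dz = - X\<^sup>p\<^sup>+\<^sup>1 / p\<close>.\<close>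

definition ddz :: "nat \<Rightarrow> complex fls \<Rightarrow> complex fls" where
  "ddz p w = - fls_const (1 / of_nat p) * fls_X ^ (p + 1) * fls_deriv w"

definition pv_rhs ::
    "nat \<Rightarrow> complex \<Rightarrow> complex \<Rightarrow> complex \<Rightarrow> complex \<Rightarrow> complex fls \<Rightarrow> complex fls" where
  "pv_rhs p \<alpha> \<beta> \<gamma> \<delta> w =
     (1 / (2 * w) + 1 / (w - 1)) * (ddz p w)\<^sup>2 - ddz p w / zvar p
     + (w - 1)\<^sup>2 / (zvar p)\<^sup>2 * (fls_const \<alpha> * w + fls_const \<beta> / w)
     + fls_const \<gamma> * w / zvar p
     + fls_const \<delta> * w * (w + 1) / (w - 1)"

text \<open>
  The equation multiplied by \<open>z\<^sup>2 w (w - 1)\<close> with all denominators cleared, so that nothing depends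
  on the convention for division by zero at \<open>w = 0\<close> and \<open>w = 1\<close>.
\<close>

definition pv_formal_solution ::
    "nat \<Rightarrow> complex \<Rightarrow> complex \<Rightarrow> complex \<Rightarrow> complex \<Rightarrow> complex fls \<Rightarrow> bool" where
  "pv_formal_solution p \<alpha> \<beta> \<gamma> \<delta> w \<longleftrightarrow>
     (zvar p)\<^sup>2 * w * (w - 1) * ddz p (ddz p w) =
       (zvar p)\<^sup>2 * ((w - 1) / 2 + w) * (ddz p w)\<^sup>2
       - zvar p * w * (w - 1) * ddz p w
       + (w - 1) ^ 3 * (fls_const \<alpha> * w\<^sup>2 + fls_const \<beta>)
       + fls_const \<gamma> * zvar p * w\<^sup>2 * (w - 1)
       + fls_const \<delta> * (zvar p)\<^sup>2 * w\<^sup>2 * (w + 1)"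

lemma ddz_zvar:
  assumes "p > 0"
  shows "ddz p (zvar p) = 1"
proof (rule fls_eqI)
  fix n
  have d: "fls_deriv (fls_X_inv ^ p :: complex fls) = fls_const (- of_nat p) * fls_X_inv ^ (p + 1)"
  proof (rule fls_eqI)
    fix k :: int
    show "fls_nth (fls_deriv (fls_X_inv ^ p :: complex fls)) k
        = fls_nth (fls_const (- of_nat p) * fls_X_inv ^ (p + 1)) k"
    proof (cases "k + 1 = - int p")
      case True
      then have "k = - int (p + 1)" "(of_int (k + 1) :: complex) = - of_nat p" by simp_all
      then show ?thesis
        using True by (simp only: fls_deriv_nth fls_X_inv_power_nth fls_mult_const_nth) simp
    next
      case False
      then have "k \<noteq> - int (p + 1)" by simp
      then show ?thesis
        using False by (simp only: fls_deriv_nth fls_X_inv_power_nth fls_mult_const_nth) simp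
    qed
  qed
  have "fls_X * fls_X_inv = (1 :: complex fls)"
    by (simp add: fls_X_inv_times_conv_shift)
  hence "fls_X ^ (p + 1) * fls_X_inv ^ (p + 1) = (1 :: complex fls)"
    by (metis power_mult_distrib power_one)
  moreover have "ddz p (zvar p) = - fls_const (1 / of_nat p) * fls_const (- of_nat p)
      * (fls_X ^ (p + 1) * fls_X_inv ^ (p + 1))"
    unfolding ddz_def zvar_def d by (simp only: mult_ac)
  moreover have "- fls_const (1 / of_nat p) * fls_const (- of_nat p) = (1 :: complex fls)"
    using assms by simp
  ultimately show "fls_nth (ddz p (zvar p)) n = fls_nth 1 n"
    by simp
qed

lemma ddz_mult: "ddz p (f * g) = f * ddz p g + ddz p f * g"
  by (simp add: ddz_def algebra_simps)

lemma pv_formal_solution_iff: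
  assumes "w \<noteq> 0" "w \<noteq> 1"
  shows "pv_formal_solution p \<alpha> \<beta> \<gamma> \<delta> w \<longleftrightarrow> ddz p (ddz p w) = pv_rhs p \<alpha> \<beta> \<gamma> \<delta> w"
proof -
  have z: "zvar p \<noteq> 0" by (simp add: zvar_def)
  have w: "w - 1 \<noteq> 0" using assms by simp
  let ?m = "(zvar p)\<^sup>2 * w * (w - 1)"
  have two: "(2 :: complex fls) \<noteq> 0" by simp
  have "?m * pv_rhs p \<alpha> \<beta> \<gamma> \<delta> w =
       (zvar p)\<^sup>2 * ((w - 1) / 2 + w) * (ddz p w)\<^sup>2
       - zvar p * w * (w - 1) * ddz p w
       + (w - 1) ^ 3 * (fls_const \<alpha> * w\<^sup>2 + fls_const \<beta>)
       + fls_const \<gamma> * zvar p * w\<^sup>2 * (w - 1)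
       + fls_const \<delta> * (zvar p)\<^sup>2 * w\<^sup>2 * (w + 1)"
  proof -
    have 1: "?m * ((1 / (2 * w) + 1 / (w - 1)) * (ddz p w)\<^sup>2)
        = (zvar p)\<^sup>2 * ((w - 1) / 2 + w) * (ddz p w)\<^sup>2"
      using assms(1) w two by (simp add: field_simps)
    have 2: "?m * (ddz p w / zvar p) = zvar p * w * (w - 1) * ddz p w"
      using z by (simp add: power2_eq_square)
    have 3: "?m * ((w - 1)\<^sup>2 / (zvar p)\<^sup>2 * (fls_const \<alpha> * w + fls_const \<beta> / w))
        = (w - 1) ^ 3 * (fls_const \<alpha> * w\<^sup>2 + fls_const \<beta>)"
    proof -
      have "w * (fls_const \<alpha> * w + fls_const \<beta> / w) = fls_const \<alpha> * w\<^sup>2 + fls_const \<beta>"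
        using assms(1) by (simp add: power2_eq_square distrib_left mult_ac)
      moreover have "?m * ((w - 1)\<^sup>2 / (zvar p)\<^sup>2 * (fls_const \<alpha> * w + fls_const \<beta> / w))
          = (w - 1) ^ 3 * (w * (fls_const \<alpha> * w + fls_const \<beta> / w))"
        using z by (simp add: power2_eq_square power3_eq_cube mult_ac)
      ultimately show ?thesis by simp
    qed
    have 4: "?m * (fls_const \<gamma> * w / zvar p) = fls_const \<gamma> * zvar p * w\<^sup>2 * (w - 1)"
      using z by (simp add: power2_eq_square mult_ac)
    have 5: "?m * (fls_const \<delta> * w * (w + 1) / (w - 1)) = fls_const \<delta> * (zvar p)\<^sup>2 * w\<^sup>2 * (w + 1)"
      using w by (simp add: power2_eq_square mult_ac)
    show ?thesis
      unfolding pv_rhs_def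
      by (simp only: distrib_left[of ?m] right_diff_distrib[of ?m] 1 2 3 4 5)
  qed
  moreover have "?m \<noteq> 0" using z w assms(1) by simp
  ultimately show ?thesis
    unfolding pv_formal_solution_def
    by (metis mult_left_cancel)
qed

text \<open>
  \<open>w = c\<^sub>0 x\<^sup>-\<^sup>m + c\<^sub>1 x\<^sup>-\<^sup>m\<^sup>-\<^sup>1 + \<dots> + c\<^sub>j x\<^sup>-\<^sup>m\<^sup>-\<^sup>j + \<dots>\<close>, where \<open>c\<^sub>0, \<dots>, c\<^sub>j\<close> is the list \<open>cs\<close> and the
  remaining coefficients are arbitrary.
\<close>

definition starts_with :: "int \<Rightarrow> complex list \<Rightarrow> complex fls \<Rightarrow> bool" where
  "starts_with m cs w \<longleftrightarrow>
     (\<forall>n<m. fls_nth w n = 0) \<and> (\<forall>i<length cs. fls_nth w (m + int i) = cs ! i)"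

text \<open>
  The families of formal solutions.  The extra arguments are the chosen square roots:
  \<open>r = \<surd>(\<beta>/\<delta>)\<close> in \<open>pv_A\<close>, \<open>r = \<surd>(-\<delta>/\<alpha>)\<close> and \<open>q = \<surd>(-\<alpha>\<delta>)\<close> in \<open>pv_C\<close>, \<open>r = \<surd>(-\<beta>/\<gamma>)\<close> in \<open>pv_D\<close>,
  \<open>r = \<surd>(-\<gamma>/\<alpha>)\<close> in \<open>pv_E\<close>.
\<close>

definition pv_A ::
    "complex \<Rightarrow> complex \<Rightarrow> complex \<Rightarrow> complex \<Rightarrow> complex \<Rightarrow> nat \<Rightarrow> complex fls \<Rightarrow> bool" where
  "pv_A \<alpha> \<beta> \<gamma> \<delta> r l w \<longleftrightarrow>
     starts_with 1 [(-1) ^ l * r, - 2 * \<beta> / \<delta> + (-1) ^ l * (\<gamma> / (2 * \<delta>)) * r] w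
     \<and> pv_formal_solution 1 \<alpha> \<beta> \<gamma> \<delta> w"

definition pv_B ::
    "complex \<Rightarrow> complex \<Rightarrow> complex \<Rightarrow> complex \<Rightarrow> complex fls \<Rightarrow> bool" where
  "pv_B \<alpha> \<beta> \<gamma> \<delta> w \<longleftrightarrow>
     starts_with 0 [- 1, 2 * \<gamma> / \<delta>] w \<and> pv_formal_solution 1 \<alpha> \<beta> \<gamma> \<delta> w"

definition pv_C ::
    "complex \<Rightarrow> complex \<Rightarrow> complex \<Rightarrow> complex \<Rightarrow> complex \<Rightarrow> complex \<Rightarrow> nat \<Rightarrow> complex fls \<Rightarrow> bool" where
  "pv_C \<alpha> \<beta> \<gamma> \<delta> r q l w \<longleftrightarrow>
     starts_with (-1) [(-1) ^ l * r, 2 + (-1) ^ l * (\<gamma> / (2 * q))] w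
     \<and> pv_formal_solution 1 \<alpha> \<beta> \<gamma> \<delta> w"

definition pv_D ::
    "complex \<Rightarrow> complex \<Rightarrow> complex \<Rightarrow> complex \<Rightarrow> complex \<Rightarrow> nat \<Rightarrow> complex fls \<Rightarrow> bool" where
  "pv_D \<alpha> \<beta> \<gamma> \<delta> r l w \<longleftrightarrow>
     starts_with 1 [(-1) ^ l * r, \<beta> / \<gamma>] w \<and> pv_formal_solution 2 \<alpha> \<beta> \<gamma> \<delta> w"

definition pv_E ::
    "complex \<Rightarrow> complex \<Rightarrow> complex \<Rightarrow> complex \<Rightarrow> complex \<Rightarrow> nat \<Rightarrow> complex fls \<Rightarrow> bool" where
  "pv_E \<alpha> \<beta> \<gamma> \<delta> r l w \<longleftrightarrow>
     starts_with (-1) [(-1) ^ l * r, 1] w \<and> pv_formal_solution 2 \<alpha> \<beta> \<gamma> \<delta> w"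

text \<open>The argument \<open>s\<close> is the Gevrey order, i.e. \<open>s = 1/\<kappa>\<close>.\<close>

definition gevrey_fps :: "real \<Rightarrow> complex fps \<Rightarrow> bool" where
  "gevrey_fps s f \<longleftrightarrow> (\<exists>C>0. \<exists>A>0. \<forall>n. norm (fps_nth f n) \<le> C * fact n powr s * A ^ n)"

definition gevrey_fls :: "real \<Rightarrow> complex fls \<Rightarrow> bool" where
  "gevrey_fls s w \<longleftrightarrow> gevrey_fps s (fls_regpart w)"

end

theory Submission
  imports Defs
begin

text \<open>
  Write \<open>X = z\<^sup>-\<^sup>1\<^sup>/\<^sup>p\<close> and \<open>w = X\<^sup>m (a + X v)\<close>, where \<open>a\<close> is the prescribed leading coefficient and
  \<open>v\<close> is an unknown power series in \<open>X\<close>; the five families have \<open>m \<in> {1, 0, -1}\<close>.  With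
  \<open>\<theta> = X d/dX\<close> one has \<open>z d/dz = - \<theta>/p\<close>, and multiplying the equation by a suitable power of \<open>X\<close>
  clears all negative powers in such a way that \<open>\<theta>\<close> occurs only in the combinations
  \<open>X (\<theta> + m) u\<close> and \<open>X\<^sup>2 (\<theta> + m)\<^sup>2 u\<close> with \<open>u = a + X v\<close>: each derivative is paid for by a power of
  \<open>X\<close>.  The factor \<open>n\<^sup>2\<close> that two derivatives produce at the \<open>n\<close>-th coefficient is thus
  compensated by a shift of the index by two, and this is exactly the growth of \<open>n!\<close>.

  To make this quantitative, let \<open>\<parallel>f\<parallel> = \<Sum>\<^bsub>n<N\<^esub> \<bar>f\<^sub>n\<bar> / (n! A\<^sup>n)\<close> (\<open>gevrey_norm\<close>).  Since
  \<open>k! (n - k)! \<le> n!\<close>, it is submultiplicative, and the operators \<open>X\<close>, \<open>X (\<theta> + m)\<close> and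
  \<open>X\<^sup>2 (\<theta> + m)\<^sup>2\<close> have norm \<open>O(1/A)\<close>, even from the norm with \<open>N\<close> terms to the norm with \<open>N + 1\<close>
  terms.  Consequently the rescaled equation has the form
  \<open>X (d + l v + R v) = 0\<close>, where \<open>R\<close> is a small nonlinear operator (\<open>small_op\<close>): its \<open>n\<close>-th
  coefficient depends on \<open>v\<^sub>0, \<dots>, v\<^sub>n\<^sub>-\<^sub>1\<close> only, it vanishes for \<open>n = 0\<close>, and it is \<open>O(1/A)\<close> on balls.
  Operators with such an expansion are closed under sums and products, so \<open>d\<close> and \<open>l\<close> are found
  by multiplying out to first order; \<open>l\<close> is the derivative of the leading algebraic equation at its
  simple root \<open>a\<close>, and hence does not vanish.

  If \<open>l \<noteq> 0\<close>, then the equation \<open>v = - (d + R v)/l\<close> is a recursion for the coefficients of \<open>v\<close>, which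
  gives existence, uniqueness and the second coefficient \<open>v\<^sub>0 = - d/l\<close>.  For large \<open>A\<close> its right-hand
  side maps a fixed ball into itself for every \<open>N\<close>, so that induction on \<open>N\<close> bounds all the
  truncated norms of \<open>v\<close>: this is the Gevrey estimate of order 1
  (\<open>first_order_expansion_solution\<close>).
\<close>

section \<open>A weighted norm for Gevrey series of order one\<close>

definition gevrey_norm :: "real \<Rightarrow> nat \<Rightarrow> complex fps \<Rightarrow> real" where
  "gevrey_norm A N f = (\<Sum>n<N. norm (fps_nth f n) / (fact n * A ^ n))"

lemma gevrey_norm_nonneg: "A > 0 \<Longrightarrow> gevrey_norm A N f \<ge> 0"
  unfolding gevrey_norm_def by (intro sum_nonneg) simp

lemma gevrey_norm_mono: "A > 0 \<Longrightarrow> M \<le> N \<Longrightarrow> gevrey_norm A M f \<le> gevrey_norm A N f"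
  unfolding gevrey_norm_def by (intro sum_mono2) auto

lemma gevrey_norm_add:
  assumes "A > 0"
  shows "gevrey_norm A N (f + g) \<le> gevrey_norm A N f + gevrey_norm A N g"
proof -
  have "gevrey_norm A N (f + g)
      \<le> (\<Sum>n<N. norm (fps_nth f n) / (fact n * A ^ n) + norm (fps_nth g n) / (fact n * A ^ n))"
    unfolding gevrey_norm_def using assms
    by (intro sum_mono) (simp add: add_divide_distrib [symmetric] divide_right_mono norm_triangle_ineq)
  then show ?thesis by (simp add: gevrey_norm_def sum.distrib)
qed

lemma gevrey_norm_const_mult:
  "gevrey_norm A N (fps_const c * f) = norm c * gevrey_norm A N f"
  by (simp add: gevrey_norm_def norm_mult sum_distrib_left)

lemma gevrey_norm_const_le:
  assumes "A > 0"
  shows "gevrey_norm A N (fps_const c) \<le> norm c"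
proof -
  have "gevrey_norm A N (fps_const c) = (\<Sum>n<N. if n = 0 then norm c else 0)"
    unfolding gevrey_norm_def by (intro sum.cong) auto
  also have "\<dots> \<le> norm c" by (simp add: sum.delta)
  finally show ?thesis .
qed

text \<open>
  The weights \<open>1 / (n! A\<^sup>n)\<close> are submultiplicative because \<open>k! (n - k)!\<close> divides \<open>n!\<close>, so truncation
  to \<open>n < N\<close> keeps the Cauchy product under control exactly as for an \<open>\<ell>\<^sup>1\<close> convolution algebra.
\<close>

lemma gevrey_norm_mult:
  assumes A: "A > 0"
  shows "gevrey_norm A N (f * g) \<le> gevrey_norm A N f * gevrey_norm A N g"
proof -
  define p q where "p n = norm (fps_nth f n) / (fact n * A ^ n)"
    and "q n = norm (fps_nth g n) / (fact n * A ^ n)" for n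
  have pq: "p n \<ge> 0" "q n \<ge> 0" for n using A by (simp_all add: p_def q_def)
  have coeff: "norm (fps_nth (f * g) n) / (fact n * A ^ n) \<le> (\<Sum>k\<le>n. p k * q (n - k))" for n
  proof -
    have "norm (fps_nth (f * g) n) \<le> (\<Sum>k\<le>n. norm (fps_nth f k) * norm (fps_nth g (n - k)))"
      unfolding fps_mult_nth atLeast0AtMost using norm_sum
      by (metis (no_types, lifting) norm_mult sum.cong)
    also have "\<dots> \<le> (\<Sum>k\<le>n. p k * q (n - k) * (fact n * A ^ n))"
    proof (rule sum_mono)
      fix k assume "k \<in> {..n}"
      then have k: "k \<le> n" by simp
      have "fact k * fact (n - k) \<le> (fact n :: real)"
      proof -
        have "fact k * fact (n - k) \<le> (fact n :: nat)"
          using fact_fact_dvd_fact[of k "n - k", where 'a = nat] k by (intro dvd_imp_le) auto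
        then have "real (fact k * fact (n - k)) \<le> real (fact n)" by (simp only: of_nat_le_iff)
        then show ?thesis by simp
      qed
      moreover have "norm (fps_nth f k) * norm (fps_nth g (n - k))
          = p k * q (n - k) * (fact k * fact (n - k) * A ^ n)"
        using A k by (simp add: p_def q_def field_simps flip: power_add)
      ultimately show "norm (fps_nth f k) * norm (fps_nth g (n - k))
          \<le> p k * q (n - k) * (fact n * A ^ n)"
        using A pq by (simp add: mult_left_mono mult_right_mono)
    qed
    finally show ?thesis
      using A by (simp add: sum_distrib_right [symmetric] divide_le_eq)
  qed
  have "gevrey_norm A N (f * g) \<le> (\<Sum>n<N. \<Sum>k\<le>n. p k * q (n - k))"
    unfolding gevrey_norm_def by (intro sum_mono coeff)
  also have "\<dots> = (\<Sum>(i, j)\<in>{(i, j). i + j < N}. p i * q j)"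
    by (rule sum.triangle_reindex[symmetric])
  also have "\<dots> \<le> (\<Sum>(i, j)\<in>{..<N} \<times> {..<N}. p i * q j)"
    using pq by (intro sum_mono2) auto
  also have "\<dots> = gevrey_norm A N f * gevrey_norm A N g"
    by (simp add: gevrey_norm_def p_def q_def sum_product sum.cartesian_product)
  finally show ?thesis .
qed

text \<open>
  The source of smallness: a factor \<open>X\<^sup>j\<close> raises the index by \<open>j\<close>, which gains a factor
  \<open>n! / (n + j)!\<close> in the weight and absorbs a multiplier \<open>c\<^sub>n\<close> of that size, such as the one of a
  differential operator of order \<open>j\<close>; a factor \<open>1/A\<close> is left over.
\<close>

lemma gevrey_norm_shifted_multiplier:
  assumes A: "A \<ge> 1" and j: "j \<ge> 1" and K: "K \<ge> 0"
    and c: "\<And>n. norm (c n) * fact n \<le> K * fact (n + j)"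
    and g: "\<And>n. fps_nth g n = c n * fps_nth f n"
  shows "gevrey_norm A (Suc N) (fps_X ^ j * g) \<le> K / A * gevrey_norm A N f"
proof -
  define q where "q n = norm (fps_nth (fps_X ^ j * g) n) / (fact n * A ^ n)" for n
  have q0: "q n = 0" if "n < j" for n using that by (simp add: q_def fps_X_power_mult_nth)
  have term_le: "q (n + j) \<le> K / A * (norm (fps_nth f n) / (fact n * A ^ n))" for n
  proof -
    have "A ^ (n + 1) \<le> A ^ (n + j)" using A j by (intro power_increasing) auto
    have "q (n + j) = norm (c n) * norm (fps_nth f n) / (fact (n + j) * A ^ (n + j))"
      by (simp add: q_def fps_X_power_mult_nth g norm_mult)
    also have "\<dots> \<le> (K * fact (n + j) / fact n) * norm (fps_nth f n) / (fact (n + j) * A ^ (n + j))"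
      using c[of n] A by (intro divide_right_mono mult_right_mono) (auto simp: field_simps)
    also have "\<dots> = K / fact n * norm (fps_nth f n) / A ^ (n + j)"
      by simp
    also have "\<dots> \<le> K / fact n * norm (fps_nth f n) / A ^ (n + 1)"
      using A K \<open>A ^ (n + 1) \<le> A ^ (n + j)\<close> by (intro divide_left_mono) auto
    finally show ?thesis by (simp add: mult_ac)
  qed
  \<comment> \<open>As \<open>j \<ge> 1\<close>, the longer sum with \<open>N + j\<close> terms dominates; its first \<open>j\<close> terms vanish.\<close>
  have "gevrey_norm A (Suc N) (fps_X ^ j * g) \<le> (\<Sum>n<N + j. q n)"
    unfolding gevrey_norm_def q_def using A j by (intro sum_mono2) auto
  also have "\<dots> = (\<Sum>n<N. q (n + j))"
  proof -
    have "(\<Sum>n<N + j. q n) = (\<Sum>n\<in>{j..<N + j}. q n)"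
      using q0 by (intro sum.mono_neutral_right) auto
    then show ?thesis using sum.shift_bounds_nat_ivl[of q 0 j N] by (simp add: atLeast0LessThan)
  qed
  also have "\<dots> \<le> (\<Sum>n<N. K / A * (norm (fps_nth f n) / (fact n * A ^ n)))"
    by (intro sum_mono term_le)
  also have "\<dots> = K / A * gevrey_norm A N f" by (simp add: gevrey_norm_def sum_distrib_left)
  finally show ?thesis .
qed

section \<open>Causal operators that are bounded or small in the norm\<close>

text \<open>
  Both notions combine causality (the \<open>n\<close>-th coefficient of the image does not depend on later
  coefficients of the argument) with a bound on balls that is uniform in the truncation order \<open>N\<close> and in \<open>A \<ge> 1\<close>.
  The small operators depend on strictly earlier coefficients, which is why their bound may
  compare \<open>N + 1\<close> terms of the image with \<open>N\<close> terms of the argument.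
\<close>

definition bounded_op :: "(complex fps \<Rightarrow> complex fps) \<Rightarrow> bool" where
  "bounded_op B \<longleftrightarrow>
     (\<forall>f g n. (\<forall>k\<le>n. fps_nth f k = fps_nth g k) \<longrightarrow> fps_nth (B f) n = fps_nth (B g) n) \<and>
     (\<forall>\<rho>. \<exists>K. \<forall>A\<ge>1. \<forall>N f. gevrey_norm A N f \<le> \<rho> \<longrightarrow> gevrey_norm A N (B f) \<le> K)"

definition small_op :: "(complex fps \<Rightarrow> complex fps) \<Rightarrow> bool" where
  "small_op R \<longleftrightarrow>
     (\<forall>f. fps_nth (R f) 0 = 0) \<and>
     (\<forall>f g n. (\<forall>k<n. fps_nth f k = fps_nth g k) \<longrightarrow> fps_nth (R f) n = fps_nth (R g) n) \<and>
     (\<forall>\<rho>. \<exists>K. \<forall>A\<ge>1. \<forall>N f. gevrey_norm A N f \<le> \<rho> \<longrightarrow> gevrey_norm A (Suc N) (R f) \<le> K / A)"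

lemma bounded_op_id: "bounded_op (\<lambda>v. v)"
  unfolding bounded_op_def by auto

lemma bounded_op_const: "bounded_op (\<lambda>v. fps_const c)"
  unfolding bounded_op_def
proof (intro conjI allI impI)
  show "\<exists>K. \<forall>A\<ge>1. \<forall>N f. gevrey_norm A N f \<le> \<rho> \<longrightarrow> gevrey_norm A N (fps_const c) \<le> K" for \<rho>
    by (rule exI[of _ "norm c"]) (auto intro!: gevrey_norm_const_le)
qed auto

lemma bounded_op_add:
  assumes "bounded_op B" "bounded_op C"
  shows "bounded_op (\<lambda>v. B v + C v)"
  unfolding bounded_op_def
proof (intro conjI allI impI)
  fix \<rho>
  obtain K L where "\<And>A N f. A \<ge> 1 \<Longrightarrow> gevrey_norm A N f \<le> \<rho> \<Longrightarrow> gevrey_norm A N (B f) \<le> K"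
    "\<And>A N f. A \<ge> 1 \<Longrightarrow> gevrey_norm A N f \<le> \<rho> \<Longrightarrow> gevrey_norm A N (C f) \<le> L"
    using assms unfolding bounded_op_def by meson
  then show "\<exists>K. \<forall>A\<ge>1. \<forall>N f. gevrey_norm A N f \<le> \<rho> \<longrightarrow> gevrey_norm A N (B f + C f) \<le> K"
    by (intro exI[of _ "K + L"] allI impI order_trans[OF gevrey_norm_add] add_mono) auto
next
  fix f g :: "complex fps" and n assume h: "\<forall>k\<le>n. fps_nth f k = fps_nth g k"
  have "fps_nth (B f) n = fps_nth (B g) n" "fps_nth (C f) n = fps_nth (C g) n"
    using assms h unfolding bounded_op_def by meson+
  then show "fps_nth (B f + C f) n = fps_nth (B g + C g) n" by simp
qed

lemma bounded_op_mult:
  assumes "bounded_op B" "bounded_op C"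
  shows "bounded_op (\<lambda>v. B v * C v)"
  unfolding bounded_op_def
proof (intro conjI allI impI)
  fix \<rho>
  obtain K L where *: "\<And>A N f. A \<ge> 1 \<Longrightarrow> gevrey_norm A N f \<le> \<rho> \<Longrightarrow> gevrey_norm A N (B f) \<le> K"
    "\<And>A N f. A \<ge> 1 \<Longrightarrow> gevrey_norm A N f \<le> \<rho> \<Longrightarrow> gevrey_norm A N (C f) \<le> L"
    using assms unfolding bounded_op_def by meson
  show "\<exists>K. \<forall>A\<ge>1. \<forall>N f. gevrey_norm A N f \<le> \<rho> \<longrightarrow> gevrey_norm A N (B f * C f) \<le> K"
  proof (intro exI[of _ "K * L"] allI impI order_trans[OF gevrey_norm_mult] mult_mono)
    fix A :: real and N f assume h: "1 \<le> A" "gevrey_norm A N f \<le> \<rho>"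
    show "0 \<le> K" using *(1)[OF h] gevrey_norm_nonneg[of A N "B f"] h by linarith
  qed (auto intro: * gevrey_norm_nonneg)
next
  fix f g :: "complex fps" and n assume h: "\<forall>k\<le>n. fps_nth f k = fps_nth g k"
  have "fps_nth (B f) k = fps_nth (B g) k" "fps_nth (C f) k = fps_nth (C g) k" if "k \<le> n" for k
    using assms h that unfolding bounded_op_def by (meson order_trans)+
  then show "fps_nth (B f * C f) n = fps_nth (B g * C g) n"
    by (simp add: fps_mult_nth)
qed

lemma small_op_imp_bounded_op:
  assumes "small_op R"
  shows "bounded_op R"
  unfolding bounded_op_def
proof (intro conjI allI impI)
  fix \<rho>
  obtain K where K: "\<And>A N f. A \<ge> 1 \<Longrightarrow> gevrey_norm A N f \<le> \<rho> \<Longrightarrow> gevrey_norm A (Suc N) (R f) \<le> K / A"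
    using assms unfolding small_op_def by meson
  show "\<exists>K. \<forall>A\<ge>1. \<forall>N f. gevrey_norm A N f \<le> \<rho> \<longrightarrow> gevrey_norm A N (R f) \<le> K"
  proof (intro exI[of _ "\<bar>K\<bar>"] allI impI)
    fix A :: real and N f assume h: "1 \<le> A" "gevrey_norm A N f \<le> \<rho>"
    have "gevrey_norm A N (R f) \<le> gevrey_norm A (Suc N) (R f)"
      using h by (intro gevrey_norm_mono) auto
    also have "\<dots> \<le> K / A" by (rule K[OF h])
    also have "\<dots> \<le> \<bar>K\<bar>" using h
      by (smt (verit) abs_ge_zero divide_le_eq mult_left_le_one_le mult_le_cancel_left1)
    finally show "gevrey_norm A N (R f) \<le> \<bar>K\<bar>" .
  qed
next
  fix f g :: "complex fps" and n assume h: "\<forall>k\<le>n. fps_nth f k = fps_nth g k"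
  then show "fps_nth (R f) n = fps_nth (R g) n"
    using assms unfolding small_op_def by (meson less_imp_le)
qed

lemma small_op_shifted_multiplier:
  assumes B: "bounded_op B" and j: "j \<ge> 1"
    and c: "\<And>n. norm (c n) * fact n \<le> K * fact (n + j)"
    and M: "\<And>f n. fps_nth (M f) n = c n * fps_nth f n"
  shows "small_op (\<lambda>v. fps_X ^ j * M (B v))"
  unfolding small_op_def
proof (intro conjI allI impI)
  have "0 \<le> norm (c 0) * fact 0" by simp
  also have "\<dots> \<le> K * fact (0 + j)" by (rule c)
  finally have K: "K \<ge> 0" by (simp add: zero_le_mult_iff) (metis fact_gt_zero not_less)
  fix \<rho>
  obtain L where L: "\<And>A N f. A \<ge> 1 \<Longrightarrow> gevrey_norm A N f \<le> \<rho> \<Longrightarrow> gevrey_norm A N (B f) \<le> L"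
    using B unfolding bounded_op_def by meson
  show "\<exists>L. \<forall>A\<ge>1. \<forall>N f. gevrey_norm A N f \<le> \<rho>
      \<longrightarrow> gevrey_norm A (Suc N) (fps_X ^ j * M (B f)) \<le> L / A"
  proof (intro exI[of _ "K * L"] allI impI)
    fix A :: real and N f assume h: "1 \<le> A" "gevrey_norm A N f \<le> \<rho>"
    have "gevrey_norm A (Suc N) (fps_X ^ j * M (B f)) \<le> K / A * gevrey_norm A N (B f)"
      by (rule gevrey_norm_shifted_multiplier[OF h(1) j K c M])
    also have "\<dots> \<le> K / A * L" using h K by (intro mult_left_mono L) auto
    finally show "gevrey_norm A (Suc N) (fps_X ^ j * M (B f)) \<le> K * L / A" by simp
  qed
next
  fix f g :: "complex fps" and n assume h: "\<forall>k<n. fps_nth f k = fps_nth g k"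
  have "fps_nth (B f) (n - j) = fps_nth (B g) (n - j)" if "j \<le> n"
  proof -
    have "\<forall>k\<le>n - j. fps_nth f k = fps_nth g k" using h j that by auto
    then show ?thesis using B unfolding bounded_op_def by meson
  qed
  then show "fps_nth (fps_X ^ j * M (B f)) n = fps_nth (fps_X ^ j * M (B g)) n"
    by (simp add: fps_X_power_mult_nth M)
qed (use j in \<open>simp add: fps_X_power_mult_nth\<close>)


lemma small_op_X_mult: "bounded_op B \<Longrightarrow> small_op (\<lambda>v. fps_X * B v)"
  using small_op_shifted_multiplier[of B 1 "\<lambda>_. 1" 1 "\<lambda>f. f"] by simp

lemma small_op_add:
  assumes "small_op R" "small_op S"
  shows "small_op (\<lambda>v. R v + S v)"
  unfolding small_op_def
proof (intro conjI allI impI)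
  fix \<rho>
  obtain K L where
    "\<And>A N f. A \<ge> 1 \<Longrightarrow> gevrey_norm A N f \<le> \<rho> \<Longrightarrow> gevrey_norm A (Suc N) (R f) \<le> K / A"
    "\<And>A N f. A \<ge> 1 \<Longrightarrow> gevrey_norm A N f \<le> \<rho> \<Longrightarrow> gevrey_norm A (Suc N) (S f) \<le> L / A"
    using assms unfolding small_op_def by meson
  then show "\<exists>K. \<forall>A\<ge>1. \<forall>N f. gevrey_norm A N f \<le> \<rho>
      \<longrightarrow> gevrey_norm A (Suc N) (R f + S f) \<le> K / A"
    by (intro exI[of _ "K + L"] allI impI order_trans[OF gevrey_norm_add])
      (auto simp: add_divide_distrib intro!: add_mono)
next
  fix f g :: "complex fps" and n assume h: "\<forall>k<n. fps_nth f k = fps_nth g k"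
  have "fps_nth (R f) n = fps_nth (R g) n" "fps_nth (S f) n = fps_nth (S g) n"
    using assms h unfolding small_op_def by meson+
  then show "fps_nth (R f + S f) n = fps_nth (R g + S g) n" by simp
qed (use assms in \<open>simp add: small_op_def\<close>)

lemma small_op_const_mult:
  assumes "small_op R"
  shows "small_op (\<lambda>v. fps_const c * R v)"
  unfolding small_op_def
proof (intro conjI allI impI)
  fix \<rho>
  obtain K where
    K: "\<And>A N f. A \<ge> 1 \<Longrightarrow> gevrey_norm A N f \<le> \<rho> \<Longrightarrow> gevrey_norm A (Suc N) (R f) \<le> K / A"
    using assms unfolding small_op_def by meson
  show "\<exists>K. \<forall>A\<ge>1. \<forall>N f. gevrey_norm A N f \<le> \<rho>
      \<longrightarrow> gevrey_norm A (Suc N) (fps_const c * R f) \<le> K / A"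
  proof (intro exI[of _ "norm c * K"] allI impI)
    fix A :: real and N f assume "1 \<le> A" "gevrey_norm A N f \<le> \<rho>"
    from mult_left_mono[OF K[OF this], of "norm c"]
    show "gevrey_norm A (Suc N) (fps_const c * R f) \<le> norm c * K / A"
      by (simp add: gevrey_norm_const_mult)
  qed
next
  fix f g :: "complex fps" and n assume h: "\<forall>k<n. fps_nth f k = fps_nth g k"
  have "fps_nth (R f) n = fps_nth (R g) n"
    using assms h unfolding small_op_def by meson
  then show "fps_nth (fps_const c * R f) n = fps_nth (fps_const c * R g) n" by simp
qed (use assms in \<open>simp add: small_op_def\<close>)

section \<open>First-order expansions of nonlinear operators\<close>

text \<open>
  \<open>v\<close> enters the equations only through \<open>a + X v\<close>, so all operators of interest are a constant plus
  a multiple of \<open>X\<close>; the cofactor of \<open>X\<close> is affine in \<open>v\<close> up to a small operator.  The triple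
  \<open>(c, d, l)\<close> is calculated like a first-order Taylor expansion in the two variables \<open>X\<close> and \<open>X v\<close>.
\<close>

definition first_order_expansion ::
    "(complex fps \<Rightarrow> complex fps) \<Rightarrow> complex \<Rightarrow> complex \<Rightarrow> complex \<Rightarrow> bool" where
  "first_order_expansion F c d l \<longleftrightarrow> (\<exists>R. small_op R \<and>
     (\<forall>v. F v = fps_const c + fps_X * (fps_const d + fps_const l * v + R v)))"

lemma first_order_expansion_cong:
  "first_order_expansion F c d l \<Longrightarrow> c = c' \<Longrightarrow> d = d' \<Longrightarrow> l = l' \<Longrightarrow> first_order_expansion F c' d' l'"
  by simp

lemma small_op_zero: "small_op (\<lambda>v. 0)"
  using small_op_X_mult[OF bounded_op_const[of 0]] by simp

lemma first_order_expansion_const: "first_order_expansion (\<lambda>v. fps_const c) c 0 0"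
  unfolding first_order_expansion_def by (rule exI[of _ "\<lambda>v. 0"]) (simp add: small_op_zero)

lemma first_order_expansion_X: "first_order_expansion (\<lambda>v. fps_X) 0 1 0"
  unfolding first_order_expansion_def by (rule exI[of _ "\<lambda>v. 0"]) (simp add: small_op_zero)

lemma first_order_expansion_substitution:
  "first_order_expansion (\<lambda>v. fps_const a + fps_X * v) a 0 1"
  unfolding first_order_expansion_def by (rule exI[of _ "\<lambda>v. 0"]) (simp add: small_op_zero)

lemma first_order_expansion_add:
  assumes "first_order_expansion F c d l" "first_order_expansion G c' d' l'"
  shows "first_order_expansion (\<lambda>v. F v + G v) (c + c') (d + d') (l + l')"
proof -
  obtain R S where RS: "small_op R" "small_op S"
    and F: "F v = fps_const c + fps_X * (fps_const d + fps_const l * v + R v)"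
    and G: "G v = fps_const c' + fps_X * (fps_const d' + fps_const l' * v + S v)" for v
    using assms unfolding first_order_expansion_def by metis
  show ?thesis unfolding first_order_expansion_def
    by (rule exI[of _ "\<lambda>v. R v + S v"])
      (simp add: F G small_op_add[OF RS] algebra_simps flip: fps_const_add)
qed

lemma first_order_expansion_mult:
  assumes "first_order_expansion F c d l" "first_order_expansion G c' d' l'"
  shows "first_order_expansion (\<lambda>v. F v * G v) (c * c') (c * d' + d * c') (c * l' + l * c')"
proof -
  obtain R S where RS: "small_op R" "small_op S"
    and F: "F v = fps_const c + fps_X * (fps_const d + fps_const l * v + R v)"
    and G: "G v = fps_const c' + fps_X * (fps_const d' + fps_const l' * v + S v)" for v
    using assms unfolding first_order_expansion_def by metis
  \<comment> \<open>The product of the two cofactors of \<open>X\<close> is merely bounded, but it comes with an additional \<open>X\<close>.\<close>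
  define T where "T = (\<lambda>v. fps_const c * S v + fps_const c' * R v
    + fps_X * ((fps_const d + fps_const l * v + R v) * (fps_const d' + fps_const l' * v + S v)))"
  have "small_op T" unfolding T_def
    by (intro small_op_add small_op_const_mult RS small_op_X_mult bounded_op_mult bounded_op_add
        bounded_op_const bounded_op_id small_op_imp_bounded_op)
  moreover have "F v * G v = fps_const (c * c')
      + fps_X * (fps_const (c * d' + d * c') + fps_const (c * l' + l * c') * v + T v)" for v
    unfolding F G T_def by (simp add: algebra_simps flip: fps_const_add fps_const_mult)
  ultimately show ?thesis unfolding first_order_expansion_def by blast
qed

lemma first_order_expansion_diff:
  assumes "first_order_expansion F c d l" "first_order_expansion G c' d' l'"
  shows "first_order_expansion (\<lambda>v. F v - G v) (c - c') (d - d') (l - l')"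
proof -
  have "first_order_expansion (\<lambda>v. fps_const (-1) * G v) (- c') (- d') (- l')"
    using first_order_expansion_mult[OF first_order_expansion_const[of "-1"] assms(2)]
    by simp
  from first_order_expansion_add[OF assms(1) this] show ?thesis
    by (simp flip: fps_const_neg)
qed

text \<open>
  With \<open>\<theta> = X d/dX\<close>, the operator \<open>\<theta> + m\<close> is the conjugate of \<open>\<theta>\<close> by \<open>X\<^sup>m\<close>.
\<close>

definition euler_op :: "complex \<Rightarrow> complex fps \<Rightarrow> complex fps" where
  "euler_op m f = fps_X * fps_deriv f + fps_const m * f"

lemma euler_op_nth: "fps_nth (euler_op m f) n = (of_nat n + m) * fps_nth f n"
  by (cases n) (simp_all add: euler_op_def algebra_simps)

lemma norm_of_nat_add_le: "norm (of_nat n + m :: complex) \<le> (1 + norm m) * (n + 1)"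
proof -
  have "norm (of_nat n + m :: complex) \<le> real n + norm m"
    by (metis norm_of_nat norm_triangle_ineq)
  also have "\<dots> \<le> (1 + norm m) * (n + 1)" by (simp add: algebra_simps)
  finally show ?thesis .
qed

lemma small_op_euler: "small_op (\<lambda>v. fps_X * euler_op m v)"
proof -
  have "norm (of_nat n + m) * fact n \<le> (1 + norm m) * fact (n + 1)" for n
    using mult_right_mono[OF norm_of_nat_add_le[of n m], of "fact n"] by (simp add: algebra_simps)
  from small_op_shifted_multiplier[OF bounded_op_id _ this euler_op_nth] show ?thesis by simp
qed

text \<open>
  Here the order of the equation meets the Gevrey order: \<open>\<bar>n + m\<bar>\<^sup>2\<close> is \<open>O((n + 1) (n + 2))\<close>, and
  \<open>(n + 1) (n + 2) n! = (n + 2)!\<close>.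
\<close>

lemma small_op_euler2: "small_op (\<lambda>v. fps_X\<^sup>2 * euler_op m (euler_op m v))"
proof (rule small_op_shifted_multiplier[OF bounded_op_id])
  fix n
  have "norm ((of_nat n + m)\<^sup>2) \<le> ((1 + norm m) * (n + 1))\<^sup>2"
    unfolding norm_power by (intro power_mono norm_of_nat_add_le) auto
  also have "\<dots> \<le> (1 + norm m)\<^sup>2 * (real (n + 1) * real (n + 2))"
    unfolding power_mult_distrib by (intro mult_left_mono) (auto simp: power2_eq_square)
  finally have "norm ((of_nat n + m)\<^sup>2) * fact n
      \<le> (1 + norm m)\<^sup>2 * (real (n + 1) * real (n + 2)) * fact n"
    by (rule mult_right_mono) simp
  then show "norm ((of_nat n + m)\<^sup>2) * fact n \<le> (1 + norm m)\<^sup>2 * fact (n + 2)"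
    by (simp add: algebra_simps)
qed (simp_all add: euler_op_nth power2_eq_square)

lemma euler_op_substitution:
  "euler_op m (fps_const a + fps_X * v) = fps_const (m * a) + fps_X * euler_op (m + 1) v"
  by (rule fps_ext) (simp add: euler_op_nth algebra_simps)

lemma first_order_expansion_euler:
  "first_order_expansion (\<lambda>v. fps_X * euler_op m (fps_const a + fps_X * v)) 0 (m * a) 0"
  unfolding first_order_expansion_def
  by (rule exI[of _ "\<lambda>v. fps_X * euler_op (m + 1) v"])
    (simp add: euler_op_substitution small_op_euler)

lemma first_order_expansion_euler2:
  "first_order_expansion (\<lambda>v. fps_X\<^sup>2 * euler_op m (euler_op m (fps_const a + fps_X * v))) 0 0 0"
  unfolding first_order_expansion_def
proof (intro exI conjI allI)
  show "small_op (\<lambda>v. fps_X * fps_const (m * (m * a)) + fps_X\<^sup>2 * euler_op (m + 1) (euler_op (m + 1) v))"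
    by (intro small_op_add small_op_X_mult bounded_op_const small_op_euler2)
qed (simp only: euler_op_substitution, simp add: distrib_left mult_ac power2_eq_square)

section \<open>Unique solvability and the Gevrey bound\<close>

text \<open>
  The \<open>n\<close>-th coefficient of the iterates \<open>T\<^sup>k 0\<close> is stationary for \<open>k > n\<close>; its final values form the
  fixed point.
\<close>

lemma strictly_causal_fixpoint:
  fixes T :: "complex fps \<Rightarrow> complex fps"
  assumes T: "\<And>f g n. (\<And>k. k < n \<Longrightarrow> fps_nth f k = fps_nth g k) \<Longrightarrow> fps_nth (T f) n = fps_nth (T g) n"
  shows "\<exists>!v. v = T v"
proof (rule ex_ex1I)
  have step: "fps_nth ((T ^^ Suc m) 0) n = fps_nth ((T ^^ Suc n) 0) n" if "n \<le> m" for m n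
    using that
  proof (induction n arbitrary: m rule: less_induct)
    case (less n)
    have "fps_nth ((T ^^ m) 0) k = fps_nth ((T ^^ n) 0) k" if k: "k < n" for k
    proof -
      obtain m' n' where "m = Suc m'" "n = Suc n'"
        using k less.prems by (cases m; cases n) auto
      moreover have "k \<le> m'" "k \<le> n'" using calculation k less.prems by auto
      ultimately show ?thesis using less.IH[OF k, of m'] less.IH[OF k, of n'] by metis
    qed
    then show ?case unfolding funpow.simps o_apply by (rule T)
  qed
  define v where "v = Abs_fps (\<lambda>n. fps_nth ((T ^^ Suc n) 0) n)"
  have "fps_nth v n = fps_nth (T v) n" for n
  proof -
    have "fps_nth v k = fps_nth ((T ^^ n) 0) k" if "k < n" for k
      using step[of k "n - 1"] that by (simp add: v_def)
    then have "fps_nth (T v) n = fps_nth (T ((T ^^ n) 0)) n" by (rule T)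
    then show ?thesis by (simp add: v_def)
  qed
  then have "v = T v" by (rule fps_ext)
  then show "\<exists>v. v = T v" ..
next
  fix f g assume fg: "f = T f" "g = T g"
  have "fps_nth f n = fps_nth g n" for n
  proof (induction n rule: less_induct)
    case (less n)
    then have "fps_nth (T f) n = fps_nth (T g) n" by (rule T)
    then show ?case using fg by metis
  qed
  then show "f = g" by (rule fps_ext)
qed

text \<open>
  Solved for the linear term, the equation is the fixed-point equation of a strictly causal
  operator.  A ball of radius slightly larger than \<open>\<bar>d/l\<bar>\<close> is mapped into itself once \<open>A\<close> is large,
  and since the bound for \<open>N + 1\<close> terms uses only \<open>N\<close> terms of \<open>v\<close>, no convergence has to be known
  in advance.
\<close>

lemma first_order_expansion_solution:
  assumes E: "first_order_expansion E 0 d l" and l: "l \<noteq> 0"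
  shows "\<exists>!v. E v = 0"
    and "E v = 0 \<Longrightarrow> fps_nth v 0 = - d / l"
    and "E v = 0 \<Longrightarrow> \<exists>C A. C > 0 \<and> A \<ge> 1 \<and> (\<forall>n. norm (fps_nth v n) \<le> C * fact n * A ^ n)"
proof -
  obtain R where R: "small_op R"
    and E': "\<And>v. E v = fps_X * (fps_const d + fps_const l * v + R v)"
    using E unfolding first_order_expansion_def by auto
  define T where "T v = fps_const (- d / l) + fps_const (- 1 / l) * R v" for v
  have eq: "E v = 0 \<longleftrightarrow> v = T v" for v
  proof -
    have "E v = 0 \<longleftrightarrow> fps_const d + fps_const l * v + R v = 0" by (simp add: E')
    also have "fps_const d + fps_const l * v + R v = fps_const l * (v - T v)"
    proof -
      have "fps_const l * T v = - fps_const d - R v"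
        using l by (simp add: T_def distrib_left mult.assoc [symmetric] del: fps_const_neg)
          (simp add: fps_const_neg [symmetric] del: fps_const_neg)
      then show ?thesis by (simp add: right_diff_distrib)
    qed
    also have "\<dots> = 0 \<longleftrightarrow> v = T v" using l by simp
    finally show ?thesis .
  qed
  show "\<exists>!v. E v = 0" unfolding eq
  proof (rule strictly_causal_fixpoint)
    fix f g :: "complex fps" and n assume "\<And>k. k < n \<Longrightarrow> fps_nth f k = fps_nth g k"
    then have "fps_nth (R f) n = fps_nth (R g) n" using R unfolding small_op_def by meson
    then show "fps_nth (T f) n = fps_nth (T g) n" by (simp add: T_def)
  qed
  assume "E v = 0"
  then have v: "v = T v" by (simp add: eq)
  have R0: "fps_nth (R v) 0 = 0" using R by (simp add: small_op_def)
  have "fps_nth v 0 = fps_nth (T v) 0" using v by (rule arg_cong)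
  then show "fps_nth v 0 = - d / l" by (simp add: T_def R0)
  define \<rho> where "\<rho> = norm (d / l) + 1"
  obtain K where
    K: "\<And>A N f. A \<ge> 1 \<Longrightarrow> gevrey_norm A N f \<le> \<rho> \<Longrightarrow> gevrey_norm A (Suc N) (R f) \<le> K / A"
    using R unfolding small_op_def by meson
  \<comment> \<open>The contribution \<open>K / (A \<bar>l\<bar>)\<close> of the small part must not exceed the margin \<open>1\<close> in \<open>\<rho>\<close>.\<close>
  define A where "A = max 1 (K / norm l)"
  have A: "A \<ge> 1" "K / (A * norm l) \<le> 1"
  proof -
    have "K / norm l \<le> A" by (simp add: A_def)
    then have "K \<le> A * norm l" using l by (simp add: pos_divide_le_eq)
    then show "K / (A * norm l) \<le> 1" using l by (simp add: A_def pos_divide_le_eq)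
  qed (simp add: A_def)
  have bound: "gevrey_norm A N v \<le> \<rho>" for N
  proof (induction N)
    case 0
    then show ?case by (simp add: gevrey_norm_def \<rho>_def)
  next
    case (Suc N)
    have "gevrey_norm A (Suc N) v = gevrey_norm A (Suc N) (T v)" using v by (rule arg_cong)
    also have "\<dots> \<le> gevrey_norm A (Suc N) (fps_const (- d / l))
        + gevrey_norm A (Suc N) (fps_const (- 1 / l) * R v)"
      unfolding T_def using A by (intro gevrey_norm_add) auto
    also have "\<dots> \<le> norm (d / l) + norm (1 / l) * (K / A)"
      unfolding gevrey_norm_const_mult
      using A gevrey_norm_const_le[of A "Suc N" "- d / l"]
        mult_left_mono[OF K[OF A(1) Suc.IH], of "norm (1 / l)"]
      by (intro add_mono) (simp_all add: norm_divide)
    also have "norm (1 / l) * (K / A) \<le> 1"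
      using A by (simp add: norm_divide mult.commute)
    finally show ?case by (simp add: \<rho>_def)
  qed
  have "norm (fps_nth v n) \<le> \<rho> * fact n * A ^ n" for n
  proof -
    have "norm (fps_nth v n) / (fact n * A ^ n) \<le> gevrey_norm A (Suc n) v"
      unfolding gevrey_norm_def using A by (intro member_le_sum) auto
    with bound[of "Suc n"] have "norm (fps_nth v n) / (fact n * A ^ n) \<le> \<rho>" by linarith
    then show ?thesis using A by (simp add: divide_le_eq mult.assoc)
  qed
  moreover have "\<rho> > 0" unfolding \<rho>_def by (smt (verit) norm_ge_zero)
  ultimately show "\<exists>C A. C > 0 \<and> A \<ge> 1 \<and> (\<forall>n. norm (fps_nth v n) \<le> C * fact n * A ^ n)"
    using A(1) by blast
qed

section \<open>From Laurent series to power series\<close>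

definition series_with_head :: "int \<Rightarrow> complex \<Rightarrow> complex fps \<Rightarrow> complex fls" where
  "series_with_head m a v = fls_X_intpow m * fps_to_fls (fps_const a + fps_X * v)"

lemma series_with_head_nth:
  "fls_nth (series_with_head m a v) n =
     (if n < m then 0 else if n = m then a else fps_nth v (nat (n - m) - 1))"
  by (simp add: series_with_head_def fls_X_intpow_times_conv_shift nat_diff_distrib)

lemma starts_with_iff_series_with_head:
  "starts_with m [a, b] w \<longleftrightarrow> (\<exists>v. w = series_with_head m a v \<and> fps_nth v 0 = b)"
proof
  assume w: "starts_with m [a, b] w"
  define v where "v = Abs_fps (\<lambda>n. fls_nth w (m + 1 + int n))"
  have m: "fls_nth w m = a" "fls_nth w (m + 1) = b" "\<And>n. n < m \<Longrightarrow> fls_nth w n = 0"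
    using w by (force simp: starts_with_def)+
  have "w = series_with_head m a v"
  proof (rule fls_eqI)
    show "fls_nth w n = fls_nth (series_with_head m a v) n" for n
      using m by (auto simp: series_with_head_nth v_def of_nat_diff)
  qed
  then show "\<exists>v. w = series_with_head m a v \<and> fps_nth v 0 = b"
    using m by (auto simp: v_def)
qed (auto simp: starts_with_def series_with_head_nth less_Suc_eq)

lemma series_with_head_inject: "series_with_head m a v = series_with_head m a v' \<longleftrightarrow> v = v'"
  by (auto simp: series_with_head_def)

text \<open>
  The coefficient of \<open>X\<^sup>n\<close> is \<open>v\<^sub>k\<close> with \<open>k = n - m - 1\<close>.  The hypothesis \<open>m \<ge> -1\<close> gives \<open>k \<le> n\<close>, so the
  bound for \<open>v\<close> carries over with the same \<open>A\<close>.
\<close>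

lemma gevrey_series_with_head:
  assumes "m \<ge> -1" "C > 0" "A \<ge> 1" and v: "\<And>n. norm (fps_nth v n) \<le> C * fact n * A ^ n"
  shows "gevrey_fls 1 (series_with_head m a v)"
  unfolding gevrey_fls_def gevrey_fps_def
proof (intro exI conjI allI)
  fix n
  have FA: "fact n * A ^ n \<ge> 1" using mult_mono[of 1 "fact n :: real" 1 "A ^ n"] assms by simp
  have "norm (fls_nth (series_with_head m a v) (int n)) \<le> (C + norm a) * (fact n * A ^ n)"
  proof -
    consider "int n < m" | "int n = m" | "int n > m" by linarith
    then show ?thesis
    proof cases
      case 1
      then show ?thesis using assms by (simp add: series_with_head_nth)
    next
      case 2
      have "norm a * 1 \<le> (C + norm a) * (fact n * A ^ n)" using assms FA by (intro mult_mono) auto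
      then show ?thesis using 2 by (simp add: series_with_head_nth)
    next
      case 3
      define k where "k = nat (int n - m) - 1"
      have k: "k \<le> n" using 3 assms by (simp add: k_def)
      have "norm (fls_nth (series_with_head m a v) (int n)) = norm (fps_nth v k)"
        using 3 by (simp add: series_with_head_nth k_def)
      also have "\<dots> \<le> C * (fact k * A ^ k)" using v[of k] by (simp add: mult.assoc)
      also have "\<dots> \<le> (C + norm a) * (fact n * A ^ n)"
        using k assms by (intro mult_mono fact_mono power_increasing) auto
      finally show ?thesis .
    qed
  qed
  then show "norm (fps_nth (fls_regpart (series_with_head m a v)) n)
      \<le> (C + norm a) * fact n powr 1 * A ^ n"
    by (simp add: mult.assoc)
qed (use assms in \<open>auto intro: add_pos_nonneg\<close>)

text \<open>
  The equation alone forces the second coefficient \<open>b\<close>; prescribing it is consistent precisely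
  because \<open>b = - d/l\<close>.
\<close>

lemma unique_gevrey_series:
  assumes E: "first_order_expansion E 0 d l" "l \<noteq> 0" and b: "b = - d / l" and m: "m \<ge> -1"
    and S: "\<And>v. S (series_with_head m a v) \<longleftrightarrow> E v = 0"
  shows "(\<exists>!w. starts_with m [a, b] w \<and> S w) \<and>
    (\<forall>w. starts_with m [a, b] w \<and> S w \<longrightarrow> gevrey_fls 1 w)"
proof -
  note sol = first_order_expansion_solution[OF E]
  have iff: "starts_with m [a, b] w \<and> S w \<longleftrightarrow> (\<exists>v. w = series_with_head m a v \<and> E v = 0)" for w
    unfolding starts_with_iff_series_with_head using S sol(2) b by auto
  show ?thesis
  proof (intro conjI allI impI)
    show "\<exists>!w. starts_with m [a, b] w \<and> S w"
      unfolding iff using sol(1) by (metis series_with_head_inject)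
  next
    fix w assume "starts_with m [a, b] w \<and> S w"
    then obtain v where "w = series_with_head m a v" "E v = 0" unfolding iff by auto
    with sol(3)[of v] m show "gevrey_fls 1 w" by (auto intro: gevrey_series_with_head)
  qed
qed

section \<open>The rescaled fifth Painleve equation\<close>

text \<open>
  The difference of the two sides of the fifth Painleve equation, cleared of denominators, for
  \<open>w = (s/t) u\<close> with \<open>u = a + X v\<close>, multiplied by \<open>t\<^sup>3 X\<^sup>2 / s\<^sup>2\<close>.  The monomials
  \<open>s\<close> and \<open>t\<close> with \<open>s/t = X\<^sup>m\<close> replace the possibly negative power of \<open>X\<close>, so that one polynomial
  expression serves zeros (\<open>s = X\<close>), finite values (\<open>s = t = 1\<close>) and poles (\<open>t = X\<close>) of \<open>w\<close> at infinity.
  The other parameters are \<open>e = 1/p\<^sup>2\<close> (from \<open>z d/dz = - \<theta>/p\<close>), \<open>\<sigma> = X\<^sup>2 / (s t)\<^sup>2\<close>, and the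
  rescaled coefficients \<open>g = \<gamma> z X\<^sup>2\<close> and \<open>d = \<delta> z\<^sup>2 X\<^sup>2\<close>.  Powers of unknowns are written as
  products, to match the product rule for first-order expansions.
\<close>

definition pv_operator ::
    "complex \<Rightarrow> complex \<Rightarrow> complex fps \<Rightarrow> complex fps \<Rightarrow> complex fps \<Rightarrow> complex \<Rightarrow> complex \<Rightarrow>
     complex fps \<Rightarrow> complex fps \<Rightarrow> complex \<Rightarrow> complex fps \<Rightarrow> complex fps" where
  "pv_operator e m s t \<sigma> \<alpha> \<beta> g d a v =
     (let u = fps_const a + fps_X * v; su = s * u;
          Y = fps_X * euler_op m u; W = fps_X\<^sup>2 * euler_op m (euler_op m u)
      in fps_const e * (u * (su - t) * W - fps_const (1 / 2) * (fps_const 3 * su - t) * (Y * Y))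
         - \<sigma> * ((su - t) * (su - t) * (su - t))
             * (fps_const \<alpha> * (su * su) + fps_const \<beta> * (t * t))
         - g * (u * u) * (su - t)
         - d * (u * u) * (su + t))"

lemma fls_euler_intpow:
  "fls_X * fls_deriv (fls_X_intpow m * fps_to_fls u)
     = fls_X_intpow m * fps_to_fls (euler_op (of_int m) u)" for u :: "complex fps"
proof (rule fls_eqI)
  fix n
  show "fls_nth (fls_X * fls_deriv (fls_X_intpow m * fps_to_fls u)) n =
      fls_nth (fls_X_intpow m * fps_to_fls (euler_op (of_int m) u)) n"
  proof (cases "n < m")
    case False
    then have "of_nat (nat (n - m)) = (of_int n - of_int m :: complex)"
      by (metis of_int_diff of_int_of_nat_eq int_nat_eq diff_ge_0_iff_ge not_less)
    with False show ?thesis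
      by (simp add: fls_X_intpow_times_conv_shift fls_X_times_conv_shift euler_op_nth)
  qed (simp add: fls_X_intpow_times_conv_shift fls_X_times_conv_shift)
qed

lemma zvar_mult_X_power: "zvar p * fls_X ^ p = 1"
  by (simp add: zvar_def power_mult_distrib [symmetric] fls_X_inv_times_conv_shift)

lemma zvar_ddz: "zvar p * ddz p w = - fls_const (1 / of_nat p) * (fls_X * fls_deriv w)"
proof -
  have "zvar p * ddz p w = - fls_const (1 / of_nat p) * (zvar p * fls_X ^ p) * (fls_X * fls_deriv w)"
    by (simp add: ddz_def mult_ac)
  then show ?thesis by (simp add: zvar_mult_X_power)
qed

lemma zvar_ddz2:
  assumes "p > 0"
  shows "(zvar p)\<^sup>2 * ddz p (ddz p w) = zvar p * ddz p (zvar p * ddz p w) - zvar p * ddz p w"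
  by (simp add: ddz_mult ddz_zvar[OF assms] algebra_simps power2_eq_square)

text \<open>
  The algebra behind the rescaling, with \<open>h = 1/2\<close> and \<open>w0\<close>, \<open>w1\<close>, \<open>w2\<close> standing for \<open>w\<close>, \<open>z w'\<close> and
  \<open>(z d/dz)\<^sup>2 w\<close>.  The terms \<open>z\<^sup>2 w''\<close> and \<open>z w'\<close> of the equation combine to \<open>(z d/dz)\<^sup>2 w\<close>.
\<close>

lemma pv_cleared_rescaled:
  fixes w0 :: "'a :: idom"
  assumes h: "h + h = 1" and S: "S = M * T" and \<sigma>: "\<sigma> * (S\<^sup>2 * T\<^sup>2) = X\<^sup>2"
    and Y: "Y = X * U1" and W: "W = X\<^sup>2 * U2"
    and w: "w0 = M * U" and w1: "w1 = - c * (M * U1)" and w2: "w2 = c * (c * (M * U2))"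
    and g: "g = \<gamma> * Z * X\<^sup>2" and d: "d = \<delta> * Z\<^sup>2 * X\<^sup>2"
  shows "(w0 * (w0 - 1) * (w2 - w1) - (((w0 - 1) * h + w0) * w1\<^sup>2 - w0 * (w0 - 1) * w1
      + (w0 - 1) ^ 3 * (\<alpha> * w0\<^sup>2 + \<beta>) + \<gamma> * Z * w0\<^sup>2 * (w0 - 1) + \<delta> * Z\<^sup>2 * w0\<^sup>2 * (w0 + 1)))
      * (T ^ 3 * X\<^sup>2)
    = S\<^sup>2 * (c * c * (U * (S * U - T) * W - h * (3 * (S * U) - T) * (Y * Y))
         - \<sigma> * ((S * U - T) * (S * U - T) * (S * U - T)) * (\<alpha> * ((S * U) * (S * U)) + \<beta> * (T * T))
         - g * (U * U) * (S * U - T) - d * (U * U) * (S * U + T))"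
proof -
  have h': "(w0 - 1) * h + w0 = h * (3 * w0 - 1)" using h by algebra
  have "S\<^sup>2 * (\<sigma> * ((S * U - T) * (S * U - T) * (S * U - T)) * (\<alpha> * ((S * U) * (S * U)) + \<beta> * (T * T)))
      = (\<sigma> * (S\<^sup>2 * T\<^sup>2)) * ((w0 - 1) ^ 3 * (\<alpha> * w0\<^sup>2 + \<beta>) * T ^ 3)"
    unfolding S w by (simp add: algebra_simps power2_eq_square power3_eq_cube)
  then have 1: "S\<^sup>2 * (\<sigma> * ((S * U - T) * (S * U - T) * (S * U - T)) * (\<alpha> * ((S * U) * (S * U)) + \<beta> * (T * T)))
      = (w0 - 1) ^ 3 * (\<alpha> * w0\<^sup>2 + \<beta>) * (T ^ 3 * X\<^sup>2)"
    unfolding \<sigma> by (simp only: mult_ac)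
  have 2: "S\<^sup>2 * (c * c * (U * (S * U - T) * W - h * (3 * (S * U) - T) * (Y * Y)))
      = (w0 * (w0 - 1) * w2 - h * (3 * w0 - 1) * w1\<^sup>2) * (T ^ 3 * X\<^sup>2)"
    unfolding S w w1 w2 Y W by (simp add: algebra_simps power2_eq_square power3_eq_cube)
  have 3: "S\<^sup>2 * (g * (U * U) * (S * U - T)) = \<gamma> * Z * w0\<^sup>2 * (w0 - 1) * (T ^ 3 * X\<^sup>2)"
    unfolding S w g by (simp add: algebra_simps power2_eq_square power3_eq_cube)
  have 4: "S\<^sup>2 * (d * (U * U) * (S * U + T)) = \<delta> * Z\<^sup>2 * w0\<^sup>2 * (w0 + 1) * (T ^ 3 * X\<^sup>2)"
    unfolding S w d by (simp add: algebra_simps power2_eq_square power3_eq_cube)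
  show ?thesis unfolding h' right_diff_distrib[of "S\<^sup>2"] 1 2 3 4
    by (simp add: algebra_simps)
qed

lemma pv_formal_solution_iff_pv_operator:
  assumes p: "p > 0" and t: "t \<noteq> 0"
    and s: "fps_to_fls s = fls_X_intpow m * fps_to_fls t"
    and \<sigma>: "\<sigma> * (s\<^sup>2 * t\<^sup>2) = fps_X\<^sup>2"
    and g: "fps_to_fls g = fls_const \<gamma> * zvar p * fls_X\<^sup>2"
    and d: "fps_to_fls d = fls_const \<delta> * (zvar p)\<^sup>2 * fls_X\<^sup>2"
  shows "pv_formal_solution p \<alpha> \<beta> \<gamma> \<delta> (series_with_head m a v) \<longleftrightarrow>
     pv_operator (1 / of_nat p * (1 / of_nat p)) (of_int m) s t \<sigma> \<alpha> \<beta> g d a v = 0"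
proof -
  define u where "u = fps_const a + fps_X * v"
  define u1 where "u1 = euler_op (of_int m) u"
  define u2 where "u2 = euler_op (of_int m) u1"
  define w0 where "w0 = series_with_head m a v"
  define w1 where "w1 = zvar p * ddz p w0"
  define w2 where "w2 = zvar p * ddz p w1"
  define c :: "complex fls" where "c = fls_const (1 / of_nat p)"
  have w0: "w0 = fls_X_intpow m * fps_to_fls u" by (simp add: w0_def series_with_head_def u_def)
  have w1: "w1 = - c * (fls_X_intpow m * fps_to_fls u1)"
    unfolding w1_def zvar_ddz w0 fls_euler_intpow u1_def c_def ..
  have "zvar p * ddz p (- c * f) = - c * (zvar p * ddz p f)" for f
    by (simp add: ddz_def c_def algebra_simps)
  then have w2: "w2 = c * (c * (fls_X_intpow m * fps_to_fls u2))"
    unfolding w2_def w1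
    by (simp only: zvar_ddz fls_euler_intpow u2_def c_def mult_minus_left mult_minus_right minus_minus)
  have dd: "(zvar p)\<^sup>2 * ddz p (ddz p w0) = w2 - w1"
    unfolding w2_def w1_def by (rule zvar_ddz2[OF p])
  have half: "(w0 - 1) / 2 = (w0 - 1) * fls_const (1 / 2)"
  proof -
    have "fls_const (1 / 2) + fls_const (1 / 2) = (1 :: complex fls)"
      unfolding fls_plus_const by simp
    then have "inverse 2 = (fls_const (1 / 2) :: complex fls)"
      by (intro inverse_unique) (simp only: mult_2)
    then show ?thesis by (simp only: divide_inverse)
  qed
  define D where "D = w0 * (w0 - 1) * (w2 - w1)
      - (((w0 - 1) * fls_const (1 / 2) + w0) * w1\<^sup>2 - w0 * (w0 - 1) * w1
      + (w0 - 1) ^ 3 * (fls_const \<alpha> * w0\<^sup>2 + fls_const \<beta>) + fls_const \<gamma> * zvar p * w0\<^sup>2 * (w0 - 1)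
      + fls_const \<delta> * (zvar p)\<^sup>2 * w0\<^sup>2 * (w0 + 1))"
  have "pv_formal_solution p \<alpha> \<beta> \<gamma> \<delta> w0 \<longleftrightarrow> D = 0"
  proof -
    have 1: "(zvar p)\<^sup>2 * w0 * (w0 - 1) * ddz p (ddz p w0) = w0 * (w0 - 1) * (w2 - w1)"
      unfolding dd[symmetric] by (simp only: mult_ac)
    have 2: "(zvar p)\<^sup>2 * ((w0 - 1) / 2 + w0) * (ddz p w0)\<^sup>2
        = ((w0 - 1) * fls_const (1 / 2) + w0) * w1\<^sup>2"
      unfolding half w1_def power_mult_distrib by (simp only: mult_ac)
    have 3: "zvar p * w0 * (w0 - 1) * ddz p w0 = w0 * (w0 - 1) * w1"
      unfolding w1_def by (simp only: mult_ac)
    show ?thesis unfolding pv_formal_solution_def D_def 1 2 3 by (simp only: right_minus_eq)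
  qed
  also have "\<dots> \<longleftrightarrow> D * (fps_to_fls t ^ 3 * fls_X\<^sup>2) = 0" using t by simp
  also have "D * (fps_to_fls t ^ 3 * fls_X\<^sup>2)
      = (fps_to_fls s)\<^sup>2 * fps_to_fls
          (pv_operator (1 / of_nat p * (1 / of_nat p)) (of_int m) s t \<sigma> \<alpha> \<beta> g d a v)"
  proof -
    have half': "fls_const (1 / 2) + fls_const (1 / 2) = (1 :: complex fls)"
      unfolding fls_plus_const by simp
    have \<sigma>': "fps_to_fls \<sigma> * ((fps_to_fls s)\<^sup>2 * (fps_to_fls t)\<^sup>2) = fls_X\<^sup>2"
      using arg_cong[OF \<sigma>, of fps_to_fls] by (simp add: fls_times_fps_to_fls fps_to_fls_power)
    show ?thesis unfolding D_def
      unfolding pv_cleared_rescaled[OF half' s \<sigma>' refl refl w0 w1 w2 g d]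
      unfolding pv_operator_def Let_def u_def [symmetric] u1_def [symmetric] u2_def [symmetric]
      by (simp add: fls_times_fps_to_fls fps_to_fls_power c_def mult.assoc)
  qed
  also have "\<dots> = 0 \<longleftrightarrow>
      pv_operator (1 / of_nat p * (1 / of_nat p)) (of_int m) s t \<sigma> \<alpha> \<beta> g d a v = 0"
    using s t by auto
  finally show ?thesis by (simp add: w0_def)
qed

lemmas first_order_expansion_intros =
  first_order_expansion_euler first_order_expansion_euler2 first_order_expansion_substitution
  first_order_expansion_const first_order_expansion_X first_order_expansion_diff
  first_order_expansion_add first_order_expansion_mult

lemma zvar_X_simps:
  "zvar (Suc 0) * fls_X = 1"
  "zvar (Suc 0) * (zvar (Suc 0) * (fls_X * fls_X)) = 1"
  "zvar 2 * (fls_X * fls_X) = 1"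
proof -
  have 1: "zvar (Suc 0) * fls_X = 1" and 2: "zvar 2 * fls_X\<^sup>2 = 1"
    using zvar_mult_X_power[of 1] zvar_mult_X_power[of 2] by simp_all
  show "zvar (Suc 0) * fls_X = 1" "zvar (Suc 0) * (zvar (Suc 0) * (fls_X * fls_X)) = 1"
    "zvar 2 * (fls_X * fls_X) = 1"
    using 1 2 by (simp_all add: power2_eq_square) algebra
qed

lemma fls_X_eq_intpow: "fps_to_fls fps_X = fls_X_intpow 1 * fps_to_fls (fps_const (1 :: complex))"
  unfolding fls_X_intpow_times_conv_shift by (rule fls_eqI) simp

lemma fls_one_eq_intpow: "fps_to_fls (fps_const (1 :: complex)) = fls_X_intpow (- 1) * fps_to_fls fps_X"
  unfolding fls_X_intpow_times_conv_shift by (rule fls_eqI) simp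

lemma fls_one_eq_intpow_0: "fps_to_fls (fps_const (1 :: complex)) = fls_X_intpow 0 * fps_to_fls (fps_const 1)"
  by simp

section \<open>The five families of formal solutions\<close>

text \<open>
  In each of the five cases the triple consists of the values at \<open>X = 0\<close>, \<open>u = a\<close> of the rescaled
  equation and of its partial derivatives with respect to \<open>X\<close> and \<open>u\<close>; the differential terms do not
  contribute, as they are of second order.  In the present one the equation reduces to
  \<open>\<beta> - \<delta> u\<^sup>2 = 0\<close> at \<open>X = 0\<close>, with derivative \<open>- 2 \<delta> a\<close> at the root.
\<close>

lemma formal_solution_inverse_z:
  assumes "\<beta> = \<delta> * a\<^sup>2" "a \<noteq> 0" "\<delta> \<noteq> 0" "b = - 2 * a\<^sup>2 + \<gamma> * a / (2 * \<delta>)"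
  shows "(\<exists>!w. starts_with 1 [a, b] w \<and> pv_formal_solution 1 \<alpha> \<beta> \<gamma> \<delta> w) \<and>
    (\<forall>w. starts_with 1 [a, b] w \<and> pv_formal_solution 1 \<alpha> \<beta> \<gamma> \<delta> w \<longrightarrow> gevrey_fls 1 w)"
proof (rule unique_gevrey_series)
  show "pv_formal_solution 1 \<alpha> \<beta> \<gamma> \<delta> (series_with_head 1 a v) \<longleftrightarrow>
      pv_operator (1 / of_nat 1 * (1 / of_nat 1)) (of_int 1)
        fps_X (fps_const 1) (fps_const 1) \<alpha> \<beta> (fps_const \<gamma> * fps_X) (fps_const \<delta>) a v = 0" for v
    by (rule pv_formal_solution_iff_pv_operator[OF _ _ fls_X_eq_intpow])
      (simp_all add: zvar_X_simps fls_times_fps_to_fls power2_eq_square mult.assoc)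
  show "first_order_expansion (pv_operator (1 / of_nat 1 * (1 / of_nat 1)) (of_int 1)
        fps_X (fps_const 1) (fps_const 1) \<alpha> \<beta> (fps_const \<gamma> * fps_X) (fps_const \<delta>) a)
      0 (\<gamma> * a\<^sup>2 - 4 * \<delta> * a ^ 3) (- 2 * \<delta> * a)"
    unfolding pv_operator_def Let_def
    by (rule first_order_expansion_cong, (rule first_order_expansion_intros)+)
      (simp_all add: assms(1) eval_nat_numeral algebra_simps)
  show "b = - (\<gamma> * a\<^sup>2 - 4 * \<delta> * a ^ 3) / (- 2 * \<delta> * a)"
    unfolding assms(4) using assms(2,3) by (simp add: field_simps eval_nat_numeral)
qed (use assms(2,3) in auto)

text \<open>
  At \<open>X = 0\<close> only \<open>- \<delta> u\<^sup>2 (u + 1)\<close> remains, because \<open>\<sigma> = X\<^sup>2\<close> suppresses the terms with \<open>\<alpha>\<close> and \<open>\<beta>\<close>.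
\<close>

lemma formal_solution_near_minus_one:
  assumes "a = - 1" "a \<noteq> 0" "\<delta> \<noteq> 0" "b = 2 * \<gamma> / \<delta>"
  shows "(\<exists>!w. starts_with 0 [a, b] w \<and> pv_formal_solution 1 \<alpha> \<beta> \<gamma> \<delta> w) \<and>
    (\<forall>w. starts_with 0 [a, b] w \<and> pv_formal_solution 1 \<alpha> \<beta> \<gamma> \<delta> w \<longrightarrow> gevrey_fls 1 w)"
proof (rule unique_gevrey_series)
  show "pv_formal_solution 1 \<alpha> \<beta> \<gamma> \<delta> (series_with_head 0 a v) \<longleftrightarrow>
      pv_operator (1 / of_nat 1 * (1 / of_nat 1)) (of_int 0)
        (fps_const 1) (fps_const 1) (fps_X * fps_X) \<alpha> \<beta> (fps_const \<gamma> * fps_X) (fps_const \<delta>) a v = 0" for v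
    by (rule pv_formal_solution_iff_pv_operator[OF _ _ fls_one_eq_intpow_0])
      (simp_all add: zvar_X_simps fls_times_fps_to_fls power2_eq_square mult.assoc)
  show "first_order_expansion (pv_operator (1 / of_nat 1 * (1 / of_nat 1)) (of_int 0)
        (fps_const 1) (fps_const 1) (fps_X * fps_X) \<alpha> \<beta> (fps_const \<gamma> * fps_X) (fps_const \<delta>) a)
      0 (2 * \<gamma>) (- \<delta>)"
    unfolding pv_operator_def Let_def
    by (rule first_order_expansion_cong, (rule first_order_expansion_intros)+)
      (simp_all add: assms(1) eval_nat_numeral algebra_simps)
  show "b = - (2 * \<gamma>) / (- \<delta>)"
    unfolding assms(4) using assms(2,3) by (simp add: field_simps eval_nat_numeral)
qed (use assms(2,3) in auto)

text \<open>
  At \<open>X = 0\<close> the equation is \<open>- u\<^sup>3 (\<alpha> u\<^sup>2 + \<delta>) = 0\<close>, with the nonzero roots \<open>a\<^sup>2 = - \<delta>/\<alpha>\<close>.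
\<close>

lemma formal_solution_linear_z:
  assumes "\<delta> = - \<alpha> * a\<^sup>2" "a \<noteq> 0" "\<alpha> \<noteq> 0" "b = 2 - \<gamma> / (2 * \<alpha> * a)"
  shows "(\<exists>!w. starts_with (- 1) [a, b] w \<and> pv_formal_solution 1 \<alpha> \<beta> \<gamma> \<delta> w) \<and>
    (\<forall>w. starts_with (- 1) [a, b] w \<and> pv_formal_solution 1 \<alpha> \<beta> \<gamma> \<delta> w \<longrightarrow> gevrey_fls 1 w)"
proof (rule unique_gevrey_series)
  show "pv_formal_solution 1 \<alpha> \<beta> \<gamma> \<delta> (series_with_head (- 1) a v) \<longleftrightarrow>
      pv_operator (1 / of_nat 1 * (1 / of_nat 1)) (of_int (- 1))
        (fps_const 1) fps_X (fps_const 1) \<alpha> \<beta> (fps_const \<gamma> * fps_X) (fps_const \<delta>) a v = 0" for v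
    by (rule pv_formal_solution_iff_pv_operator[OF _ _ fls_one_eq_intpow])
      (simp_all add: zvar_X_simps fls_times_fps_to_fls power2_eq_square mult.assoc)
  show "first_order_expansion (pv_operator (1 / of_nat 1 * (1 / of_nat 1)) (of_int (- 1))
        (fps_const 1) fps_X (fps_const 1) \<alpha> \<beta> (fps_const \<gamma> * fps_X) (fps_const \<delta>) a)
      0 (4 * \<alpha> * a ^ 4 - \<gamma> * a ^ 3) (- 2 * \<alpha> * a ^ 4)"
    unfolding pv_operator_def Let_def
    by (rule first_order_expansion_cong, (rule first_order_expansion_intros)+)
      (simp_all add: assms(1) eval_nat_numeral algebra_simps)
  show "b = - (4 * \<alpha> * a ^ 4 - \<gamma> * a ^ 3) / (- 2 * \<alpha> * a ^ 4)"
    unfolding assms(4) using assms(2,3) by (simp add: field_simps eval_nat_numeral)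
qed (use assms(2,3) in auto)

text \<open>
  For \<open>\<delta> = 0\<close> the term with \<open>\<gamma>\<close> takes over.  In the variable \<open>\<surd>z\<close> it becomes \<open>g = \<gamma>\<close>, and the equation
  at \<open>X = 0\<close> is \<open>\<beta> + \<gamma> u\<^sup>2 = 0\<close>.
\<close>

lemma formal_solution_inverse_sqrt_z:
  assumes "\<beta> = - \<gamma> * a\<^sup>2" "a \<noteq> 0" "\<gamma> \<noteq> 0" "b = - a\<^sup>2" "\<delta> = 0"
  shows "(\<exists>!w. starts_with 1 [a, b] w \<and> pv_formal_solution 2 \<alpha> \<beta> \<gamma> \<delta> w) \<and>
    (\<forall>w. starts_with 1 [a, b] w \<and> pv_formal_solution 2 \<alpha> \<beta> \<gamma> \<delta> w \<longrightarrow> gevrey_fls 1 w)"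
proof (rule unique_gevrey_series)
  show "pv_formal_solution 2 \<alpha> \<beta> \<gamma> \<delta> (series_with_head 1 a v) \<longleftrightarrow>
      pv_operator (1 / of_nat 2 * (1 / of_nat 2)) (of_int 1)
        fps_X (fps_const 1) (fps_const 1) \<alpha> \<beta> (fps_const \<gamma>) (fps_const 0) a v = 0" for v
    by (rule pv_formal_solution_iff_pv_operator[OF _ _ fls_X_eq_intpow])
      (simp_all add: assms(5) zvar_X_simps fls_times_fps_to_fls power2_eq_square mult.assoc)
  show "first_order_expansion (pv_operator (1 / of_nat 2 * (1 / of_nat 2)) (of_int 1)
        fps_X (fps_const 1) (fps_const 1) \<alpha> \<beta> (fps_const \<gamma>) (fps_const 0) a)
      0 (2 * \<gamma> * a ^ 3) (2 * \<gamma> * a)"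
    unfolding pv_operator_def Let_def
    by (rule first_order_expansion_cong, (rule first_order_expansion_intros)+)
      (simp_all add: assms(1) eval_nat_numeral algebra_simps)
  show "b = - (2 * \<gamma> * a ^ 3) / (2 * \<gamma> * a)"
    unfolding assms(4) using assms(2,3) by (simp add: field_simps eval_nat_numeral)
qed (use assms(2,3) in auto)

text \<open>
  At \<open>X = 0\<close> the equation is \<open>- u\<^sup>3 (\<alpha> u\<^sup>2 + \<gamma>) = 0\<close>.
\<close>

lemma formal_solution_sqrt_z:
  assumes "\<gamma> = - \<alpha> * a\<^sup>2" "a \<noteq> 0" "\<alpha> \<noteq> 0" "b = 1" "\<delta> = 0"
  shows "(\<exists>!w. starts_with (- 1) [a, b] w \<and> pv_formal_solution 2 \<alpha> \<beta> \<gamma> \<delta> w) \<and>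
    (\<forall>w. starts_with (- 1) [a, b] w \<and> pv_formal_solution 2 \<alpha> \<beta> \<gamma> \<delta> w \<longrightarrow> gevrey_fls 1 w)"
proof (rule unique_gevrey_series)
  show "pv_formal_solution 2 \<alpha> \<beta> \<gamma> \<delta> (series_with_head (- 1) a v) \<longleftrightarrow>
      pv_operator (1 / of_nat 2 * (1 / of_nat 2)) (of_int (- 1))
        (fps_const 1) fps_X (fps_const 1) \<alpha> \<beta> (fps_const \<gamma>) (fps_const 0) a v = 0" for v
    by (rule pv_formal_solution_iff_pv_operator[OF _ _ fls_one_eq_intpow])
      (simp_all add: assms(5) zvar_X_simps fls_times_fps_to_fls power2_eq_square mult.assoc)
  show "first_order_expansion (pv_operator (1 / of_nat 2 * (1 / of_nat 2)) (of_int (- 1))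
        (fps_const 1) fps_X (fps_const 1) \<alpha> \<beta> (fps_const \<gamma>) (fps_const 0) a)
      0 (2 * \<alpha> * a ^ 4) (- 2 * \<alpha> * a ^ 4)"
    unfolding pv_operator_def Let_def
    by (rule first_order_expansion_cong, (rule first_order_expansion_intros)+)
      (simp_all add: assms(1) eval_nat_numeral algebra_simps)
  show "b = - (2 * \<alpha> * a ^ 4) / (- 2 * \<alpha> * a ^ 4)"
    unfolding assms(4) using assms(2,3) by (simp add: field_simps eval_nat_numeral)
qed (use assms(2,3) in auto)

lemma sign_mult_square: "((-1) ^ l * r)\<^sup>2 = r\<^sup>2" for r :: complex
  by (simp add: power_mult_distrib flip: power_mult)

theorem theorem3:
  fixes \<alpha> \<beta> \<gamma> \<delta> :: complex
  shows
    "(\<alpha> * \<beta> * \<gamma> * \<delta> \<noteq> 0 \<longrightarrow>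
        (\<forall>r. r\<^sup>2 = \<beta> / \<delta> \<longrightarrow>
          (\<forall>l\<in>{1, 2}. (\<exists>!w. pv_A \<alpha> \<beta> \<gamma> \<delta> r l w) \<and>
                      (\<forall>w. pv_A \<alpha> \<beta> \<gamma> \<delta> r l w \<longrightarrow> gevrey_fls 1 w))) \<and>
        (\<exists>!w. pv_B \<alpha> \<beta> \<gamma> \<delta> w) \<and>
        (\<forall>w. pv_B \<alpha> \<beta> \<gamma> \<delta> w \<longrightarrow> gevrey_fls 1 w) \<and>
        (\<forall>r q. r\<^sup>2 = - \<delta> / \<alpha> \<and> q\<^sup>2 = - \<alpha> * \<delta> \<and> r * q = \<delta> \<longrightarrow>
          (\<forall>l\<in>{1, 2}. (\<exists>!w. pv_C \<alpha> \<beta> \<gamma> \<delta> r q l w) \<and>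
                      (\<forall>w. pv_C \<alpha> \<beta> \<gamma> \<delta> r q l w \<longrightarrow> gevrey_fps 1 (fls_regpart w)))))
     \<and>
     (\<alpha> * \<beta> * \<gamma> \<noteq> 0 \<and> \<delta> = 0 \<longrightarrow>
        (\<forall>r. r\<^sup>2 = - \<beta> / \<gamma> \<longrightarrow>
          (\<forall>l\<in>{3, 4}. (\<exists>!w. pv_D \<alpha> \<beta> \<gamma> \<delta> r l w) \<and>
                      (\<forall>w. pv_D \<alpha> \<beta> \<gamma> \<delta> r l w \<longrightarrow> gevrey_fls 1 w))) \<and>
        (\<forall>r. r\<^sup>2 = - \<gamma> / \<alpha> \<longrightarrow>
          (\<forall>l\<in>{3, 4}. (\<exists>!w. pv_E \<alpha> \<beta> \<gamma> \<delta> r l w) \<and>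
                      (\<forall>w. pv_E \<alpha> \<beta> \<gamma> \<delta> r l w \<longrightarrow> gevrey_fls 1 w))))"
proof (intro conjI impI)
  assume "\<alpha> * \<beta> * \<gamma> * \<delta> \<noteq> 0"
  then have nz: "\<alpha> \<noteq> 0" "\<beta> \<noteq> 0" "\<gamma> \<noteq> 0" "\<delta> \<noteq> 0" by auto
  show "\<forall>r. r\<^sup>2 = \<beta> / \<delta> \<longrightarrow>
      (\<forall>l\<in>{1, 2}. (\<exists>!w. pv_A \<alpha> \<beta> \<gamma> \<delta> r l w) \<and> (\<forall>w. pv_A \<alpha> \<beta> \<gamma> \<delta> r l w \<longrightarrow> gevrey_fls 1 w))"
  proof (intro allI impI ballI)
    fix r and l :: nat assume r: "r\<^sup>2 = \<beta> / \<delta>"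
    show "(\<exists>!w. pv_A \<alpha> \<beta> \<gamma> \<delta> r l w) \<and> (\<forall>w. pv_A \<alpha> \<beta> \<gamma> \<delta> r l w \<longrightarrow> gevrey_fls 1 w)"
      unfolding pv_A_def
    proof (rule formal_solution_inverse_z; (unfold sign_mult_square)?)
      show "\<beta> = \<delta> * r\<^sup>2" "(-1) ^ l * r \<noteq> 0" "\<delta> \<noteq> 0" using r nz by auto
      show "- 2 * \<beta> / \<delta> + (-1) ^ l * (\<gamma> / (2 * \<delta>)) * r
          = - 2 * r\<^sup>2 + \<gamma> * ((-1) ^ l * r) / (2 * \<delta>)"
        using r by simp
    qed
  qed
  show "\<exists>!w. pv_B \<alpha> \<beta> \<gamma> \<delta> w" "\<forall>w. pv_B \<alpha> \<beta> \<gamma> \<delta> w \<longrightarrow> gevrey_fls 1 w"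
    unfolding pv_B_def
    using formal_solution_near_minus_one[of "- 1" \<delta> "2 * \<gamma> / \<delta>" \<gamma> \<alpha> \<beta>] nz by simp_all
  show "\<forall>r q. r\<^sup>2 = - \<delta> / \<alpha> \<and> q\<^sup>2 = - \<alpha> * \<delta> \<and> r * q = \<delta> \<longrightarrow>
      (\<forall>l\<in>{1, 2}. (\<exists>!w. pv_C \<alpha> \<beta> \<gamma> \<delta> r q l w) \<and>
        (\<forall>w. pv_C \<alpha> \<beta> \<gamma> \<delta> r q l w \<longrightarrow> gevrey_fps 1 (fls_regpart w)))"
  proof (intro allI impI ballI)
    fix r q and l :: nat assume "r\<^sup>2 = - \<delta> / \<alpha> \<and> q\<^sup>2 = - \<alpha> * \<delta> \<and> r * q = \<delta>"
    then have \<delta>: "\<delta> = - \<alpha> * r\<^sup>2" and rq: "r * q = \<delta>" using nz by auto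
    then have r: "r \<noteq> 0" using nz by auto
    have q: "q = - \<alpha> * r"
    proof -
      have "r * q = r * (- \<alpha> * r)" using rq \<delta> by (simp add: power2_eq_square)
      then show ?thesis using r by (metis mult_left_cancel)
    qed
    have "(-1) ^ l * (\<gamma> / (2 * q)) = - \<gamma> / (2 * \<alpha> * ((-1) ^ l * r))"
      using nz r unfolding q by (cases "even l") (auto simp: field_simps)
    then show "(\<exists>!w. pv_C \<alpha> \<beta> \<gamma> \<delta> r q l w) \<and>
        (\<forall>w. pv_C \<alpha> \<beta> \<gamma> \<delta> r q l w \<longrightarrow> gevrey_fps 1 (fls_regpart w))"
      unfolding pv_C_def gevrey_fls_def [symmetric]
      by (intro formal_solution_linear_z; (unfold sign_mult_square)?) (use \<delta> r nz in auto)
  qed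
next
  assume "\<alpha> * \<beta> * \<gamma> \<noteq> 0 \<and> \<delta> = 0"
  then have nz: "\<alpha> \<noteq> 0" "\<beta> \<noteq> 0" "\<gamma> \<noteq> 0" "\<delta> = 0" by auto
  show "\<forall>r. r\<^sup>2 = - \<beta> / \<gamma> \<longrightarrow>
      (\<forall>l\<in>{3, 4}. (\<exists>!w. pv_D \<alpha> \<beta> \<gamma> \<delta> r l w) \<and> (\<forall>w. pv_D \<alpha> \<beta> \<gamma> \<delta> r l w \<longrightarrow> gevrey_fls 1 w))"
  proof (intro allI impI ballI)
    fix r and l :: nat assume r: "r\<^sup>2 = - \<beta> / \<gamma>"
    then have "r \<noteq> 0" using nz by auto
    with r show "(\<exists>!w. pv_D \<alpha> \<beta> \<gamma> \<delta> r l w) \<and> (\<forall>w. pv_D \<alpha> \<beta> \<gamma> \<delta> r l w \<longrightarrow> gevrey_fls 1 w)"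
      unfolding pv_D_def by (intro formal_solution_inverse_sqrt_z; (unfold sign_mult_square)?) (use nz in auto)
  qed
  show "\<forall>r. r\<^sup>2 = - \<gamma> / \<alpha> \<longrightarrow>
      (\<forall>l\<in>{3, 4}. (\<exists>!w. pv_E \<alpha> \<beta> \<gamma> \<delta> r l w) \<and> (\<forall>w. pv_E \<alpha> \<beta> \<gamma> \<delta> r l w \<longrightarrow> gevrey_fls 1 w))"
  proof (intro allI impI ballI)
    fix r and l :: nat assume r: "r\<^sup>2 = - \<gamma> / \<alpha>"
    then have "r \<noteq> 0" using nz by auto
    with r show "(\<exists>!w. pv_E \<alpha> \<beta> \<gamma> \<delta> r l w) \<and> (\<forall>w. pv_E \<alpha> \<beta> \<gamma> \<delta> r l w \<longrightarrow> gevrey_fls 1 w)"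
      unfolding pv_E_def by (intro formal_solution_sqrt_z; (unfold sign_mult_square)?) (use nz in auto)
  qed
qed

end
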